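(* Let $1<L<\infty$, $1\le p<\infty$, and let $\mathcal{Z}^{(L)}$ be the zero set of $F_L$. Almost surely, the only function $f\in\mathcal{F}^p$ such that $f$ vanishes at every point of $\mathcal{Z}^{(L)}$ is $f=0$.
   Context: Fock space: for $1\le p<\infty$, $\mathcal{F}^p$ is the space of entire functions $f$ with $\|f\|_p^p=\frac{p}{2\pi}\int_{\mathbb{C}}|f(z)|^pe^{-p|z|^2/2}\,dA(z)<\infty$, where $dA$ is Lebesgue measure on $\mathbb{C}$. Gaussian entire function (GEF): for $L>0$, $F_L(z)=\sum_{n=0}^\infty \zeta_n\frac{(\sqrt{L}z)^n}{\sqrt{n!}}$, where $\zeta_n$ ($n\ge 0$) are i.i.d. standard complex normal random variables. *)

theory Defs
  imports "HOL-Probability.Probability" "HOL-Complex_Analysis.Complex_Analysis"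
begin

definition fock_norm_powr :: "real \<Rightarrow> (complex \<Rightarrow> complex) \<Rightarrow> ennreal" where
  "fock_norm_powr p f =
     ennreal (p / (2 * pi)) *
     (\<integral>\<^sup>+z. ennreal (norm (f z) powr p * exp (- p * (norm z)\<^sup>2 / 2)) \<partial>lborel)"

definition fock_space :: "real \<Rightarrow> (complex \<Rightarrow> complex) set" where
  "fock_space p = {f. f holomorphic_on UNIV \<and> fock_norm_powr p f < \<infinity>}"

text \<open>
  Normalisation of the standard complex normal law: mean 0 and E |Z|^2 = 1, so that the real
  and imaginary parts are independent real normals of variance 1/2.
\<close>

definition std_complex_normal_density :: "complex \<Rightarrow> real" where
  "std_complex_normal_density z = exp (- (norm z)\<^sup>2) / pi"

definition iid_std_complex_normal :: "'w measure \<Rightarrow> (nat \<Rightarrow> 'w \<Rightarrow> complex) \<Rightarrow> bool" where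
  "iid_std_complex_normal M \<zeta> \<longleftrightarrow>
     prob_space.indep_vars M (\<lambda>_. borel) \<zeta> UNIV \<and>
     (\<forall>n. distributed M lborel (\<zeta> n) std_complex_normal_density)"

text \<open>
  The function below takes a single realisation \<open>a\<close> of the coefficient sequence. Almost surely
  the series converges at every point; on the exceptional null set its value is immaterial.
\<close>

definition gef :: "real \<Rightarrow> (nat \<Rightarrow> complex) \<Rightarrow> complex \<Rightarrow> complex" where
  "gef L a z = (\<Sum>n. a n * ((of_real (sqrt L) * z) ^ n / of_real (sqrt (fact n))))"

definition gef_zeros :: "real \<Rightarrow> (nat \<Rightarrow> complex) \<Rightarrow> complex set" where
  "gef_zeros L a = {z. gef L a z = 0}"

end

theory Submission imports Defs begin

text \<open>
  Let \<open>F\<close> be a sample of the Gaussian entire function and let \<open>f\<close> be a Fock space function that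
  vanishes on its zeros. Almost surely \<open>F\<close> has only simple zeros
  (\<open>AE_no_double_zero\<close>), so the quotient \<open>g = f / F\<close> is entire
  (\<open>holomorphic_quotient_simple_zeros\<close>). The claim is that \<open>g\<close> is integrable with respect to
  area; an integrable entire function is zero (\<open>entire_integrable_imp_zero\<close>), hence \<open>f = 0\<close>.

  The numerator satisfies \<open>|f z| \<le> C * exp ((|z| + 3)^2 / 2)\<close>
  (\<open>fock_space_pointwise_bound\<close>). The denominator is controlled through the
  expectation of \<open>1 / |F z|\<close>. At a fixed point \<open>z\<close> the value \<open>F z\<close> is affine in each
  coefficient \<open>\<zeta> n\<close> separately, with slope of modulus \<open>sqrt ((L * |z|^2)^n / n!)\<close> and with an
  independent remainder. Because \<open>1 / |z|\<close> is locally integrable in the plane, averaging over this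
  one coefficient bounds the expectation by \<open>17\<close> divided by the modulus of the slope
  (\<open>nn_integral_inverse_gef_le\<close>). Some \<open>n\<close> makes the slope at least a constant times
  \<open>exp (s * |z|^2 / 2)\<close> with \<open>1 < s < L\<close> (\<open>exists_large_gef_weight\<close>). So the
  expected value of the area integral of \<open>exp ((|z| + 3)^2 / 2) / |F z|\<close> is finite, and the
  integral itself is finite almost surely (\<open>AE_weighted_inverse_gef_integrable\<close>). This is where
  \<open>L > 1\<close> enters. The almost sure event depends only on \<open>F\<close>, so it serves all \<open>f\<close> at once.
\<close>

section \<open>Integration over the complex plane\<close>

lemma borel_measurable_Complex [measurable (raw)]:
  assumes "f \<in> borel_measurable M" "g \<in> borel_measurable M"
  shows "(\<lambda>x. Complex (f x) (g x)) \<in> borel_measurable M"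
  using assms by (simp add: borel_measurable_complex_iff)

lemma nn_integral_lborel_complex:
  fixes h :: "complex \<Rightarrow> ennreal"
  assumes [measurable]: "h \<in> borel_measurable borel"
  shows "(\<integral>\<^sup>+z. h z \<partial>lborel) = (\<integral>\<^sup>+x. \<integral>\<^sup>+y. h (Complex x y) \<partial>lborel \<partial>lborel)"
    and "(\<integral>\<^sup>+z. h z \<partial>lborel) = (\<integral>\<^sup>+y. \<integral>\<^sup>+x. h (Complex x y) \<partial>lborel \<partial>lborel)"
proof -
  have [measurable]: "(\<lambda>p. Complex (fst p) (snd p)) \<in> borel_measurable (borel :: (real \<times> real) measure)"
    by (intro borel_measurable_continuous_onI continuous_intros)
  have lb: "lborel = distr lborel borel (\<lambda>p::real \<times> real. Complex (fst p) (snd p))" (is "_ = ?D")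
  proof (rule lborel_eqI)
    fix l u :: complex
    assume le: "\<And>b. b \<in> Basis \<Longrightarrow> l \<bullet> b \<le> u \<bullet> b"
    have le': "Re l \<le> Re u" "Im l \<le> Im u"
      using le[of 1] le[of \<i>] by (auto simp: Basis_complex_def inner_complex_def)
    have pre: "(\<lambda>p. Complex (fst p) (snd p)) -` box l u = box (Re l) (Re u) \<times> box (Im l) (Im u)"
      by (auto simp: in_box_complex_iff box_real)
    have "emeasure ?D (box l u) = emeasure lborel (box (Re l) (Re u) \<times> box (Im l) (Im u))"
      by (subst emeasure_distr) (auto simp: pre)
    also have "\<dots> = emeasure lborel (box (Re l) (Re u)) * emeasure lborel (box (Im l) (Im u))"
      by (simp add: lborel_prod[symmetric] lborel.emeasure_pair_measure_Times)
    also have "\<dots> = (\<Prod>b\<in>Basis. (u - l) \<bullet> b)"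
      using le' by (simp add: Basis_complex_def inner_complex_def ennreal_mult)
    finally show "emeasure ?D (box l u) = (\<Prod>b\<in>Basis. (u - l) \<bullet> b)" .
  qed simp
  have "(\<integral>\<^sup>+z. h z \<partial>lborel) = (\<integral>\<^sup>+p. h (Complex (fst p) (snd p)) \<partial>lborel)"
    by (subst lb, subst nn_integral_distr) auto
  also have "\<dots> = (\<integral>\<^sup>+p. h (Complex (fst p) (snd p)) \<partial>(lborel \<Otimes>\<^sub>M lborel))"
    by (simp add: lborel_prod)
  finally have *: "(\<integral>\<^sup>+z. h z \<partial>lborel) = (\<integral>\<^sup>+p. h (Complex (fst p) (snd p)) \<partial>(lborel \<Otimes>\<^sub>M lborel))" .
  have [measurable]: "(\<lambda>p. h (Complex (fst p) (snd p))) \<in> borel_measurable (lborel \<Otimes>\<^sub>M lborel)"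
    unfolding lborel_prod by measurable
  show "(\<integral>\<^sup>+z. h z \<partial>lborel) = (\<integral>\<^sup>+x. \<integral>\<^sup>+y. h (Complex x y) \<partial>lborel \<partial>lborel)"
    unfolding * by (subst lborel.nn_integral_fst[symmetric]) auto
  show "(\<integral>\<^sup>+z. h z \<partial>lborel) = (\<integral>\<^sup>+y. \<integral>\<^sup>+x. h (Complex x y) \<partial>lborel \<partial>lborel)"
    unfolding * by (subst lborel_pair.nn_integral_snd[symmetric]) auto
qed

lemma nn_integral_gaussian_complex_finite:
  assumes "0 < c"
  shows "(\<integral>\<^sup>+z. ennreal (exp (- c * (norm (z::complex))\<^sup>2)) \<partial>lborel) < \<infinity>"
proof -
  \<comment> \<open>the standard deviation for which the normal density is a multiple of \<open>exp (- c * x^2)\<close>\<close>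
  define s where "s = 1 / sqrt (2 * c)"
  have s: "s > 0" "2 * s\<^sup>2 = 1 / c"
    using assms by (auto simp: s_def power2_eq_square real_sqrt_mult_self field_simps)
  have eq: "exp (- c * x\<^sup>2) = sqrt (2 * pi * s\<^sup>2) * normal_density 0 s x" for x
    using s assms by (simp add: normal_density_def field_simps)
  have "integrable lborel (\<lambda>x. exp (- c * x\<^sup>2))"
    unfolding eq using s by (intro integrable_mult_right integrable_normal_density)
  then have fin: "(\<integral>\<^sup>+x. ennreal (exp (- c * x\<^sup>2)) \<partial>lborel) < \<infinity>"
    by (simp add: integrable_iff_bounded)
  have "(\<integral>\<^sup>+z. ennreal (exp (- c * (norm (z::complex))\<^sup>2)) \<partial>lborel)
      = (\<integral>\<^sup>+x. \<integral>\<^sup>+y. ennreal (exp (- c * x\<^sup>2)) * ennreal (exp (- c * y\<^sup>2)) \<partial>lborel \<partial>lborel)"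
    by (subst nn_integral_lborel_complex(1))
       (simp_all add: cmod_power2 ring_distribs exp_add ennreal_mult exp_minus exp_diff divide_inverse)
  also have "\<dots> = (\<integral>\<^sup>+x. ennreal (exp (- c * x\<^sup>2)) \<partial>lborel) * (\<integral>\<^sup>+y. ennreal (exp (- c * y\<^sup>2)) \<partial>lborel)"
    by (simp add: nn_integral_cmult nn_integral_multc)
  also have "\<dots> < \<infinity>"
    using fin by (simp add: ennreal_mult_less_top)
  finally show ?thesis .
qed

section \<open>An area sub-mean value inequality\<close>

text \<open>
  The passage from contour integrals, which are gauge integrals over an interval, to the
  nonnegative Lebesgue integrals in which all area estimates below are carried out.
\<close>

lemma norm_integral_le_nn_integral:
  fixes h :: "real \<Rightarrow> complex"
  assumes "continuous_on {a..b} h"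
  shows "ennreal (norm (integral {a..b} h)) \<le> (\<integral>\<^sup>+s. indicator {a..b} s * ennreal (norm (h s)) \<partial>lborel)"
proof -
  have int: "set_integrable lborel {a..b} h"
    using assms by (rule borel_integrable_atLeastAtMost')
  then have "norm (integral {a..b} h) = norm (LINT s:{a..b}|lborel. h s)"
    by (simp add: set_borel_integral_eq_integral)
  also have "ennreal \<dots> \<le> (\<integral>\<^sup>+s. norm (indicator {a..b} s *\<^sub>R h s) \<partial>lborel)"
    using int unfolding set_integrable_def set_lebesgue_integral_def
    by (rule integral_norm_bound_ennreal)
  also have "\<dots> = (\<integral>\<^sup>+s. indicator {a..b} s * ennreal (norm (h s)) \<partial>lborel)"
    by (intro nn_integral_cong) (auto simp: indicator_def)
  finally show ?thesis .
qed

lemma norm_contour_integral_horizontal_le: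
  assumes "a < b" "continuous_on (closed_segment (Complex a c) (Complex b c)) h"
  shows "ennreal (norm (contour_integral (linepath (Complex a c) (Complex b c)) h))
           \<le> (\<integral>\<^sup>+s. indicator {a..b} s * ennreal (norm (h (Complex s c))) \<partial>lborel)"
proof -
  have "continuous_on {a..b} (\<lambda>s. h (Complex s c))"
  proof (rule continuous_on_compose2[OF assms(2)])
    show "(\<lambda>s. Complex s c) ` {a..b} \<subseteq> closed_segment (Complex a c) (Complex b c)"
      using assms(1) by (auto simp: closed_segment_same_Im closed_segment_eq_real_ivl)
  qed (intro continuous_intros)
  note cont = this
  have "contour_integral (linepath (Complex a c) (Complex b c)) h
          = contour_integral (linepath (of_real a) (of_real b)) (\<lambda>w. h (w + \<i> * of_real c))"
    by (simp add: contour_integral_integral linepath_def Complex_eq scaleR_conv_of_real algebra_simps)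
  also have "\<dots> = integral {a..b} (\<lambda>s. h (Complex s c))"
    using assms(1) by (simp add: contour_integral_linepath_Reals_eq Complex_eq)
  finally show ?thesis
    using norm_integral_le_nn_integral[OF cont] by simp
qed

lemma norm_contour_integral_vertical_le:
  assumes "a < b" "continuous_on (closed_segment (Complex c a) (Complex c b)) h"
  shows "ennreal (norm (contour_integral (linepath (Complex c a) (Complex c b)) h))
           \<le> (\<integral>\<^sup>+s. indicator {a..b} s * ennreal (norm (h (Complex c s))) \<partial>lborel)"
proof -
  have "continuous_on {a..b} (\<lambda>s. h (Complex c s))"
  proof (rule continuous_on_compose2[OF assms(2)])
    show "(\<lambda>s. Complex c s) ` {a..b} \<subseteq> closed_segment (Complex c a) (Complex c b)"
      using assms(1) by (auto simp: closed_segment_same_Re closed_segment_eq_real_ivl)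
  qed (intro continuous_intros)
  from norm_integral_le_nn_integral[OF this] show ?thesis
    using assms(1) by (simp add: contour_integral_linepath_same_Re[of _ c _ a b] norm_mult)
qed

text \<open>
  Cauchy's formula on the boundary of the square of half-side \<open>t\<close> centred at 0, where
  \<open>|w| \<ge> 1\<close>. The integrals run over the full range \<open>{-2..2}\<close> instead of \<open>{-t..t}\<close> so that
  each of them is a slice of one and the same area integral, independent of \<open>t\<close>. Squares take
  the place of circles because their slices are handled by the Fubini theorem in Cartesian
  coordinates, without polar coordinates.
\<close>

lemma norm_le_square_boundary_integral:
  fixes f :: "complex \<Rightarrow> complex"
  assumes f: "f holomorphic_on UNIV" and t: "1 \<le> t" "t \<le> 2"
  defines "A \<equiv> \<lambda>y. \<integral>\<^sup>+s. indicator {-2..2} s * ennreal (norm (f (Complex s y))) \<partial>lborel"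
    and "B \<equiv> \<lambda>x. \<integral>\<^sup>+s. indicator {-2..2} s * ennreal (norm (f (Complex x s))) \<partial>lborel"
  shows "ennreal (norm (f 0)) \<le> (A (- t) + A t + B (- t) + B t) / 4"
proof -
  define h where "h = (\<lambda>w. f w / w)"
  define a1 a2 a3 a4 where "a1 = Complex (-t) (-t)" and "a2 = Complex t (-t)"
    and "a3 = Complex t t" and "a4 = Complex (-t) t"
  let ?R = "rectpath a1 a3"
  have R: "?R = linepath a1 a2 +++ linepath a2 a3 +++ linepath a3 a4 +++ linepath a4 a1"
    by (simp add: rectpath_def Let_def a1_def a2_def a3_def a4_def)
  have im: "path_image ?R = closed_segment a1 a2 \<union> closed_segment a2 a3 \<union>
              closed_segment a3 a4 \<union> closed_segment a4 a1"
    by (simp add: R path_image_join Un_assoc)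
  have im2: "path_image ?R \<subseteq> {w. 1 \<le> norm w}"
  proof
    fix w assume "w \<in> path_image ?R"
    then have "\<bar>Re w\<bar> = t \<or> \<bar>Im w\<bar> = t"
      using t by (auto simp: path_image_rectpath a1_def a3_def)
    then show "w \<in> {w. 1 \<le> norm w}"
      using t abs_Re_le_cmod[of w] abs_Im_le_cmod[of w] by auto
  qed
  have cont: "continuous_on (path_image ?R) h"
    unfolding h_def using im2 f
    by (intro continuous_intros holomorphic_on_imp_continuous_on[OF holomorphic_on_subset[OF f]]) auto
  have "((\<lambda>w. f w / (w - 0)) has_contour_integral (2*pi * \<i> * winding_number ?R 0 * f 0)) ?R"
    using im2 by (intro Cauchy_integral_formula_convex_simple[where S = UNIV] f) auto
  moreover have "winding_number ?R 0 = 1"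
    using t by (intro winding_number_rectpath) (auto simp: in_box_complex_iff a1_def a3_def)
  ultimately have "contour_integral ?R h = 2 * pi * \<i> * f 0"
    by (simp add: h_def contour_integral_unique)
  moreover have c: "h contour_integrable_on linepath a1 a2" "h contour_integrable_on linepath a2 a3"
       "h contour_integrable_on linepath a3 a4" "h contour_integrable_on linepath a4 a1"
    using cont unfolding im by (auto intro!: contour_integrable_continuous_linepath elim: continuous_on_subset)
  ultimately have "2 * pi * \<i> * f 0 = contour_integral (linepath a1 a2) h + contour_integral (linepath a2 a3) h
      + contour_integral (linepath a3 a4) h + contour_integral (linepath a4 a1) h"
    by (simp add: R add.assoc)
  also have "\<dots> = contour_integral (linepath a1 a2) h + contour_integral (linepath a2 a3) h
      - contour_integral (linepath a4 a3) h - contour_integral (linepath a1 a4) h"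
    using contour_integral_reverse_linepath[of a4 a3 h] contour_integral_reverse_linepath[of a1 a4 h]
      continuous_on_subset[OF cont, of "closed_segment a4 a3"]
      continuous_on_subset[OF cont, of "closed_segment a1 a4"]
    unfolding im by (simp add: closed_segment_commute le_supI1 le_supI2)
  finally have eq: "2 * pi * \<i> * f 0 = \<dots>" .
  have "4 * norm (f 0) \<le> 2 * pi * norm (f 0)"
    using pi_gt3 by (intro mult_right_mono) auto
  also have "\<dots> = norm (2 * pi * \<i> * f 0)"
    by (simp add: norm_mult)
  also have "\<dots> \<le> norm (contour_integral (linepath a1 a4) h) + norm (contour_integral (linepath a2 a3) h)
      + norm (contour_integral (linepath a1 a2) h) + norm (contour_integral (linepath a4 a3) h)"
    unfolding eq by norm
  finally have "ennreal (4 * norm (f 0)) \<le> ennreal (norm (contour_integral (linepath a1 a4) h)) 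
     + ennreal (norm (contour_integral (linepath a2 a3) h))
      + ennreal (norm (contour_integral (linepath a1 a2) h)) + ennreal (norm (contour_integral (linepath a4 a3) h))"
    by (simp flip: ennreal_plus add: ennreal_leI)
  also have "\<dots> \<le> B (-t) + B t + A (-t) + A t"
  proof (intro add_mono)
    have hf: "norm (h w) \<le> norm (f w)" if "1 \<le> norm w" for w
    proof -
      have "norm (f w) * 1 \<le> norm (f w) * norm w" using that by (intro mult_left_mono) auto
      then show ?thesis using that by (simp add: h_def norm_divide divide_le_eq mult.commute)
    qed
    have n: "1 \<le> norm w" if "\<bar>Re w\<bar> = t \<or> \<bar>Im w\<bar> = t" for w
      using that t abs_Re_le_cmod[of w] abs_Im_le_cmod[of w] by auto
    have hor: "ennreal (norm (contour_integral (linepath (Complex (-t) y) (Complex t y)) h)) \<le> A y"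
      if "\<bar>y\<bar> = t" "continuous_on (closed_segment (Complex (-t) y) (Complex t y)) h" for y
    proof (rule order.trans[OF norm_contour_integral_horizontal_le])
      show "(\<integral>\<^sup>+s. indicator {-t..t} s * ennreal (norm (h (Complex s y))) \<partial>lborel) \<le> A y"
        unfolding A_def
        by (intro nn_integral_mono mult_mono ennreal_leI hf n) (use t that in \<open>auto simp: indicator_def\<close>)
    qed (use t that in auto)
    have ver: "ennreal (norm (contour_integral (linepath (Complex x (-t)) (Complex x t)) h)) \<le> B x"
      if "\<bar>x\<bar> = t" "continuous_on (closed_segment (Complex x (-t)) (Complex x t)) h" for x
    proof (rule order.trans[OF norm_contour_integral_vertical_le])
      show "(\<integral>\<^sup>+s. indicator {-t..t} s * ennreal (norm (h (Complex x s))) \<partial>lborel) \<le> B x"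
        unfolding B_def
        by (intro nn_integral_mono mult_mono ennreal_leI hf n) (use t that in \<open>auto simp: indicator_def\<close>)
    qed (use t that in auto)
    have cs: "continuous_on (closed_segment a1 a4) h" "continuous_on (closed_segment a2 a3) h"
      "continuous_on (closed_segment a1 a2) h" "continuous_on (closed_segment a4 a3) h"
      using cont unfolding im by (auto simp: closed_segment_commute elim: continuous_on_subset)
    show "ennreal (norm (contour_integral (linepath a1 a4) h)) \<le> B (-t)"
      "ennreal (norm (contour_integral (linepath a2 a3) h)) \<le> B t"
      "ennreal (norm (contour_integral (linepath a1 a2) h)) \<le> A (-t)"
      "ennreal (norm (contour_integral (linepath a4 a3) h)) \<le> A t"
      using cs t unfolding a1_def a2_def a3_def a4_def by (auto intro!: hor ver)
  qed
  finally have "4 * ennreal (norm (f 0)) \<le> A (- t) + A t + B (- t) + B t"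
    by (simp add: ennreal_mult ac_simps)
  then have "4 * ennreal (norm (f 0)) / 4 \<le> (A (- t) + A t + B (- t) + B t) / 4"
    by (rule divide_right_mono_ennreal)
  then show ?thesis
    by (simp add: ennreal_mult_divide_eq mult.commute)
qed

text \<open>
  An area sub-mean value inequality, obtained by averaging the previous estimate over
  \<open>t \<in> {1..2}\<close>. It serves twice: it turns the integrability in the definition of the Fock
  space into a pointwise bound, and it shows that an integrable entire function is bounded.
\<close>

lemma norm_le_nn_integral_square:
  fixes f :: "complex \<Rightarrow> complex"
  assumes f: "f holomorphic_on UNIV"
  shows "ennreal (norm (f z))
           \<le> (\<integral>\<^sup>+w. indicator (cbox (Complex (-2) (-2)) (Complex 2 2)) w * ennreal (norm (f (z + w))) \<partial>lborel)"
proof -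
  define g where "g = (\<lambda>w. f (z + w))"
  have g: "g holomorphic_on UNIV"
    unfolding g_def using holomorphic_on_compose_gen[of "\<lambda>w. z + w" UNIV f UNIV, OF _ f]
    by (simp add: o_def holomorphic_intros)
  have [measurable]: "g \<in> borel_measurable borel"
    using g by (intro borel_measurable_continuous_onI holomorphic_on_imp_continuous_on)
  let ?Q = "cbox (Complex (-2) (-2)) (Complex 2 2)"
  define I where "I = (\<integral>\<^sup>+w. indicator ?Q w * ennreal (norm (g w)) \<partial>lborel)"
  define A where "A = (\<lambda>y. \<integral>\<^sup>+s. indicator {-2..2} s * ennreal (norm (g (Complex s y))) \<partial>lborel)"
  define B where "B = (\<lambda>x. \<integral>\<^sup>+s. indicator {-2..2} s * ennreal (norm (g (Complex x s))) \<partial>lborel)"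
  have [measurable]: "A \<in> borel_measurable borel" "B \<in> borel_measurable borel"
    unfolding A_def B_def by measurable
  have ind: "indicator ?Q (Complex x y) = (indicator {-2..2} x * indicator {-2..2} y :: ennreal)" for x y
    by (auto simp: indicator_def in_cbox_complex_iff)
  have I1: "I = (\<integral>\<^sup>+y. indicator {-2..2} y * A y \<partial>lborel)"
    unfolding I_def A_def
    by (subst nn_integral_lborel_complex(2)) (auto simp: ind nn_integral_cmult[symmetric] ac_simps intro!: nn_integral_cong)
  have I2: "I = (\<integral>\<^sup>+x. indicator {-2..2} x * B x \<partial>lborel)"
    unfolding I_def B_def
    by (subst nn_integral_lborel_complex(1)) (auto simp: ind nn_integral_cmult[symmetric] ac_simps intro!: nn_integral_cong)
  have le: "(\<integral>\<^sup>+t. indicator {1..2} t * G t \<partial>lborel) \<le> (\<integral>\<^sup>+t. indicator {-2..2} t * G t \<partial>lborel)"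
    for G :: "real \<Rightarrow> ennreal"
    by (intro nn_integral_mono mult_right_mono) (auto simp: indicator_def)
  have lem: "(\<integral>\<^sup>+t. indicator {1..2} t * G (- t) \<partial>lborel) \<le> (\<integral>\<^sup>+t. indicator {-2..2} t * G t \<partial>lborel)"
    if [measurable]: "G \<in> borel_measurable borel" for G :: "real \<Rightarrow> ennreal"
  proof -
    have "(\<integral>\<^sup>+t. indicator {-2..2} t * G t \<partial>lborel) = (\<integral>\<^sup>+t. indicator {-2..2} (-t) * G (-t) \<partial>lborel)"
      by (subst lborel_distr_uminus[symmetric], subst nn_integral_distr) auto
    also have "\<dots> \<ge> (\<integral>\<^sup>+t. indicator {1..2} t * G (- t) \<partial>lborel)"
      by (intro nn_integral_mono mult_right_mono) (auto simp: indicator_def)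
    finally show ?thesis .
  qed
  have "ennreal (norm (g 0)) = (\<integral>\<^sup>+t. indicator {1..2::real} t * ennreal (norm (g 0)) \<partial>lborel)"
    by (simp add: nn_integral_multc)
  also have "\<dots> \<le> (\<integral>\<^sup>+t. indicator {1..2} t * ((A (- t) + A t + B (- t) + B t) / 4) \<partial>lborel)"
    using norm_le_square_boundary_integral[OF g] unfolding A_def B_def
    by (intro nn_integral_mono) (auto simp: indicator_def)
  also have "\<dots> = ((\<integral>\<^sup>+t. indicator {1..2} t * A (- t) \<partial>lborel) + (\<integral>\<^sup>+t. indicator {1..2} t * A t \<partial>lborel)
      + (\<integral>\<^sup>+t. indicator {1..2} t * B (- t) \<partial>lborel) + (\<integral>\<^sup>+t. indicator {1..2} t * B t \<partial>lborel)) / 4"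
    by (simp add: ennreal_times_divide nn_integral_divide ring_distribs nn_integral_add)
  also have "\<dots> \<le> (I + I + I + I) / 4"
    using le[of A] le[of B] lem[of A] lem[of B]
    by (intro divide_right_mono_ennreal add_mono) (auto simp: I1[symmetric] I2[symmetric])
  also have "I + I + I + I = I * 4"
  proof -
    have "I + I + I + I = I * (1 + 1 + 1 + 1)"
      by (simp only: ring_distribs mult_1_right)
    then show ?thesis by simp
  qed
  also have "I * 4 / 4 = I"
    by (simp add: ennreal_mult_divide_eq)
  finally show ?thesis by (simp add: I_def g_def)
qed

section \<open>Growth of Fock space functions\<close>

text \<open>
  The sharp bound is \<open>C * exp (|z|^2 / 2)\<close>; enlarging \<open>|z|\<close> to \<open>|z| + 3\<close> makes the weight
  dominate its values on the whole square around \<open>z\<close>, whose points are at distance at most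
  \<open>2 * sqrt 2\<close> from \<open>z\<close>, and this loss is harmless since the
  growth of the Gaussian entire function is faster by a factor \<open>L > 1\<close> in the exponent.
\<close>

lemma fock_space_pointwise_bound:
  assumes f: "f \<in> fock_space p" and p: "1 \<le> p"
  obtains C :: real where "\<And>z. norm (f z) \<le> C * exp ((norm z + 3)\<^sup>2 / 2)"
proof -
  have hol: "f holomorphic_on UNIV" using f by (simp add: fock_space_def)
  have [measurable]: "f \<in> borel_measurable borel"
    using hol by (intro borel_measurable_continuous_onI holomorphic_on_imp_continuous_on)
  define u where "u = (\<lambda>z. ennreal (norm (f z) powr p * exp (- p * (norm z)\<^sup>2 / 2)))"
  have [measurable]: "u \<in> borel_measurable borel" unfolding u_def by measurable
  define J where "J = (\<integral>\<^sup>+z. u z \<partial>lborel)"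
  have "ennreal (p / (2 * pi)) * J < \<infinity>"
    using f by (simp add: fock_space_def fock_norm_powr_def J_def u_def)
  then have J: "J < \<infinity>" using p by (auto simp: ennreal_mult_less_top)
  let ?Q = "cbox (Complex (-2) (-2)) (Complex 2 2)"
  have Q: "(\<integral>\<^sup>+w. indicator ?Q w \<partial>lborel) = 16"
    by (simp add: emeasure_lborel_cbox_eq Basis_complex_def inner_complex_def)
  have "norm (f z) \<le> enn2real (16 + J) * exp ((norm z + 3)\<^sup>2 / 2)" for z
  proof -
    \<comment> \<open>The inequality \<open>x \<le> 1 + x powr p\<close> is applied to \<open>|f| / r\<close>: dividing by \<open>r\<close> first keeps the bound
      linear in \<open>r\<close> instead of of order \<open>r powr p\<close>.\<close>
    define r where "r = exp ((norm z + 3)\<^sup>2 / 2)"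
    have r: "r > 0" by (simp add: r_def)
    have pw: "indicator ?Q w * ennreal (norm (f (z + w))) \<le> ennreal r * (indicator ?Q w + u (z + w))" for w
    proof (cases "w \<in> ?Q")
      case True
      then have "\<bar>Re w\<bar> \<le> 2" "\<bar>Im w\<bar> \<le> 2" by (auto simp: in_cbox_complex_iff)
      then have "(Re w)\<^sup>2 \<le> 2\<^sup>2" "(Im w)\<^sup>2 \<le> 2\<^sup>2" by (metis abs_le_square_iff abs_numeral)+
      then have "(norm w)\<^sup>2 \<le> 3\<^sup>2" by (simp add: cmod_power2)
      then have "norm w \<le> 3" by (rule power2_le_imp_le) simp
      then have zw: "norm (z + w) \<le> norm z + 3"
        using norm_triangle_ineq[of z w] by linarith
      define x where "x = norm (f (z + w)) / r"
      have x: "x \<ge> 0" using r by (simp add: x_def)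
      have "x \<le> 1 + x powr p"
      proof (cases "x \<le> 1")
        case False
        then have "x powr 1 \<le> x powr p" using p by (intro powr_mono) auto
        then show ?thesis using False by simp
      qed (simp add: add_increasing2)
      also have "x powr p \<le> norm (f (z + w)) powr p * exp (- p * (norm (z + w))\<^sup>2 / 2)"
      proof -
        have "exp (p * (norm (z + w))\<^sup>2 / 2) \<le> r powr p"
          unfolding r_def using p zw
          by (simp add: powr_def power_mono mult_left_mono)
        then have "norm (f (z + w)) powr p / r powr p
            \<le> norm (f (z + w)) powr p / exp (p * (norm (z + w))\<^sup>2 / 2)"
          by (intro divide_left_mono) (use r in auto)
        moreover have "exp (- p * (norm (z + w))\<^sup>2 / 2) = 1 / exp (p * (norm (z + w))\<^sup>2 / 2)"
          using exp_minus[of "p * (norm (z + w))\<^sup>2 / 2"] by (simp add: inverse_eq_divide)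
        moreover have "x powr p = norm (f (z + w)) powr p / r powr p"
          using r by (simp add: x_def powr_divide)
        ultimately show ?thesis by simp
      qed
      finally have "r * x \<le> r * (1 + norm (f (z + w)) powr p * exp (- p * (norm (z + w))\<^sup>2 / 2))"
        using r by simp
      moreover have "r * x = norm (f (z + w))" using r by (simp add: x_def)
      ultimately have "ennreal (norm (f (z + w))) \<le>
          ennreal (r * (1 + norm (f (z + w)) powr p * exp (- p * (norm (z + w))\<^sup>2 / 2)))"
        by (simp add: ennreal_leI)
      also have "\<dots> = ennreal r * (1 + u (z + w))"
        using r unfolding u_def by (subst ennreal_mult) (auto simp: ennreal_plus)
      finally show ?thesis using True by simp
    qed simp
    have "ennreal (norm (f z)) \<le> (\<integral>\<^sup>+w. indicator ?Q w * ennreal (norm (f (z + w))) \<partial>lborel)"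
      by (rule norm_le_nn_integral_square[OF hol])
    also have "\<dots> \<le> (\<integral>\<^sup>+w. ennreal r * (indicator ?Q w + u (z + w)) \<partial>lborel)"
      by (intro nn_integral_mono pw)
    also have "\<dots> = ennreal r * (16 + (\<integral>\<^sup>+w. u (z + w) \<partial>lborel))"
      by (simp add: nn_integral_cmult nn_integral_add Q)
    also have "(\<integral>\<^sup>+w. u (z + w) \<partial>lborel) = J"
      unfolding J_def by (subst (2) lborel_distr_plus[of z, symmetric]) (simp add: nn_integral_distr)
    also have "ennreal r * (16 + J) = ennreal (enn2real (16 + J) * r)"
      using J r by (simp add: ennreal_mult mult.commute)
    finally show ?thesis
      using r by (simp add: r_def)
  qed
  then show ?thesis by (rule that)
qed

section \<open>Anticoncentration of the complex normal law\<close>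

lemma borel_measurable_std_complex_normal_density [measurable]:
  "std_complex_normal_density \<in> borel_measurable borel"
  unfolding std_complex_normal_density_def[abs_def] by measurable

lemma nn_integral_std_complex_normal_density:
  "(\<integral>\<^sup>+z. ennreal (std_complex_normal_density z) \<partial>lborel) = 1"
proof -
  define s where "s = 1 / sqrt (2::real)"
  have s: "s > 0" "s\<^sup>2 = 1 / 2" by (auto simp: s_def power_divide)
  have d: "std_complex_normal_density (Complex x y) = normal_density 0 s x * normal_density 0 s y" for x y
    by (simp add: std_complex_normal_density_def normal_density_def s cmod_power2 exp_add[symmetric]
          exp_diff exp_minus field_simps)
  have "(\<integral>\<^sup>+x. ennreal (normal_density 0 s x) \<partial>lborel) = 1"
    using prob_space.emeasure_space_1[OF prob_space_normal_density[OF s(1), of 0]]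
    by (simp add: emeasure_density)
  then show ?thesis
    by (subst nn_integral_lborel_complex(1))
       (simp_all add: d ennreal_mult nn_integral_cmult)
qed

text \<open>
  A dyadic majorant of \<open>1 / |z|\<close>: the integral of the \<open>k\<close>-th term is a multiple of
  \<open>2^k * 4^-k\<close>, which exhibits the local integrability of \<open>1 / |z|\<close> in the plane.
\<close>

lemma inverse_norm_le_dyadic:
  fixes z :: complex
  defines "Q \<equiv> \<lambda>k::nat. cbox (Complex (- (1/2^k)) (- (1/2^k))) (Complex (1/2^k) (1/2^k))"
  shows "ennreal (1 / norm z) \<le> 1 + (\<Sum>k. ennreal (2 ^ Suc k) * indicator (Q k) z)"
proof (cases "z = 0 \<or> 1 < norm z")
  case True
  then have "ennreal (1 / norm z) \<le> 1" by (auto simp: divide_le_eq_1)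
  then show ?thesis by (metis add_increasing2 zero_le)
next
  case False
  then have z: "0 < norm z" "norm z \<le> 1" by auto
  obtain n where "(1/2) ^ n < norm z"
    using real_arch_pow_inv[of "norm z" "1/2"] z by auto
  then have ex: "\<exists>n. 1 / 2 ^ n < norm z" by (auto simp: power_divide)
  define m where "m = (LEAST n. 1 / 2 ^ n < norm z)"
  have m: "1 / 2 ^ m < norm z" unfolding m_def using ex by (rule LeastI_ex)
  with z have "m \<noteq> 0" by (intro notI) simp
  then obtain k where k: "m = Suc k" by (cases m) auto
  have "\<not> 1 / 2 ^ k < norm z"
    using not_less_Least[of k "\<lambda>n. 1 / 2 ^ n < norm z"] k by (simp add: m_def)
  then have "z \<in> Q k"
    using abs_Re_le_cmod[of z] abs_Im_le_cmod[of z] by (auto simp: Q_def in_cbox_complex_iff)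
  moreover have "1 / norm z \<le> 2 ^ Suc k"
    using m z unfolding k by (simp add: field_simps)
  ultimately have "ennreal (1 / norm z) \<le> ennreal (2 ^ Suc k) * indicator (Q k) z"
    by (simp add: ennreal_leI del: power_Suc)
  also have "\<dots> = (\<Sum>i\<in>{k}. ennreal (2 ^ Suc i) * indicator (Q i) z)"
    by (simp only: sum.insert sum.empty finite.emptyI empty_iff not_False_eq_True add_0_right)
  also have "\<dots> \<le> (\<Sum>k. ennreal (2 ^ Suc k) * indicator (Q k) z)"
    by (rule sum_le_suminf) auto
  finally show ?thesis by (metis add_increasing zero_le)
qed

text \<open>
  Anticoncentration of the complex normal law, uniformly in the shift \<open>b\<close>: its density is
  bounded and \<open>1 / |z|\<close> is integrable near its pole, so wherever the pole \<open>- b / a\<close> lies it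
  contributes a bounded amount, and away from it the integrand is at most the density,
  up to the factor \<open>1 / |a|\<close>. The
  constant is 1, the total mass of the density, plus 16, the sum of the dyadic series.
\<close>

lemma nn_integral_normal_inverse_norm_affine:
  assumes a: "a \<noteq> 0"
  shows "(\<integral>\<^sup>+x. ennreal (std_complex_normal_density x) * ennreal (1 / norm (x * a + b)) \<partial>lborel)
           \<le> ennreal (17 / norm a)"
proof -
  define Q where "Q = (\<lambda>k::nat. cbox (Complex (- (1/2^k)) (- (1/2^k))) (Complex (1/2^k) (1/2^k)))"
  define S where "S = (\<lambda>z. \<Sum>k. ennreal (2 ^ Suc k) * indicator (Q k) z)"
  have [measurable]: "Q k \<in> sets borel" for k by (simp add: Q_def)
  have [measurable]: "S \<in> borel_measurable borel" unfolding S_def by measurable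
  have four: "(4::real) ^ k = 2 ^ k * 2 ^ k" for k
    by (simp flip: power_mult_distrib)
  have "emeasure lborel (Q k) = ennreal (4 / 4 ^ k)" for k
    by (simp add: Q_def emeasure_lborel_cbox_eq Basis_complex_def inner_complex_def four field_simps)
  then have "(\<integral>\<^sup>+z. S z \<partial>lborel) = (\<Sum>k. ennreal (2 ^ Suc k) * ennreal (4 / 4 ^ k))"
    unfolding S_def by (simp add: nn_integral_suminf nn_integral_cmult)
  also have "\<dots> = (\<Sum>k. ennreal (8 * (1/2) ^ k))"
    by (intro suminf_cong, subst ennreal_mult[symmetric])
       (auto simp: power_divide four field_simps)
  also have "\<dots> = ennreal 16"
  proof (rule suminf_ennreal_eq)
    have "(\<lambda>k. 8 * (1/2) ^ k) sums (8 * (1 / (1 - 1/2 :: real)))"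
      by (intro sums_mult geometric_sums) auto
    then show "(\<lambda>k. 8 * (1/2) ^ k) sums (16::real)" by simp
  qed simp
  finally have S: "(\<integral>\<^sup>+z. S z \<partial>lborel) = 16" by simp
  have d: "std_complex_normal_density x \<le> 1" for x
  proof -
    have "exp (- (norm x)\<^sup>2) \<le> 1" by simp
    also have "1 \<le> pi" using pi_gt3 by simp
    finally show ?thesis by (simp add: std_complex_normal_density_def divide_le_eq)
  qed
  have "(\<integral>\<^sup>+x. ennreal (std_complex_normal_density x) * ennreal (1 / norm (x * a + b)) \<partial>lborel)
      \<le> (\<integral>\<^sup>+x. ennreal (1 / norm a) * (ennreal (std_complex_normal_density x) + S (b / a + x)) \<partial>lborel)"
  proof (rule nn_integral_mono)
    fix x
    have "x * a + b = a * (b / a + x)" using a by (simp add: field_simps)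
    then have "ennreal (1 / norm (x * a + b)) = ennreal (1 / norm a) * ennreal (1 / norm (b / a + x))"
      by (simp add: norm_mult flip: ennreal_mult)
    also have "\<dots> \<le> ennreal (1 / norm a) * (1 + S (b / a + x))"
      unfolding S_def Q_def by (intro mult_left_mono inverse_norm_le_dyadic) auto
    finally have "ennreal (std_complex_normal_density x) * ennreal (1 / norm (x * a + b))
       \<le> ennreal (std_complex_normal_density x) * (ennreal (1 / norm a) * (1 + S (b / a + x)))"
      by (intro mult_left_mono) auto
    also have "\<dots> = ennreal (1 / norm a) * (ennreal (std_complex_normal_density x) + ennreal (std_complex_normal_density x) * S (b / a + x))"
      by (simp add: ring_distribs ac_simps)
    also have "\<dots> \<le> ennreal (1 / norm a) * (ennreal (std_complex_normal_density x) + 1 * S (b / a + x))"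
      using d[of x] by (intro mult_left_mono add_mono mult_right_mono) auto
    finally show "ennreal (std_complex_normal_density x) * ennreal (1 / norm (x * a + b))
       \<le> ennreal (1 / norm a) * (ennreal (std_complex_normal_density x) + S (b / a + x))" by simp
  qed
  also have "\<dots> = ennreal (1 / norm a) * (1 + (\<integral>\<^sup>+x. S (b / a + x) \<partial>lborel))"
    by (simp add: nn_integral_cmult nn_integral_add nn_integral_std_complex_normal_density)
  also have "(\<integral>\<^sup>+x. S (b / a + x) \<partial>lborel) = (\<integral>\<^sup>+x. S x \<partial>lborel)"
    by (subst (2) lborel_distr_plus[of "b / a", symmetric]) (simp add: nn_integral_distr)
  also have "ennreal (1 / norm a) * (1 + \<dots>) = ennreal (17 / norm a)"
    using a by (simp add: S) (simp flip: ennreal_numeral ennreal_mult)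
  finally show ?thesis .
qed

section \<open>Entire functions: critical values, division, integrability\<close>

text \<open>
  The critical points are isolated unless the function is constant, and in that case there is
  just one value.
\<close>

lemma countable_critical_values:
  assumes G: "G holomorphic_on UNIV"
  shows "countable (G ` {z. deriv G z = 0})"
proof (cases "deriv G constant_on UNIV")
  case True
  then obtain c where c: "\<And>z. deriv G z = c" by (auto simp: constant_on_def)
  show ?thesis
  proof (cases "c = 0")
    case True
    have "\<exists>k. \<forall>z\<in>UNIV. G z = k"
      using G c True
      by (intro has_field_derivative_zero_constant)
         (metis UNIV_I holomorphic_derivI open_UNIV convex_UNIV)+
    then obtain k where "\<And>z. G z = k" by auto
    then have "G ` {z. deriv G z = 0} \<subseteq> {k}" by auto
    then show ?thesis by (rule countable_subset) simp
  qed (simp add: c)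
next
  case False
  have "countable {z \<in> UNIV. deriv G z = 0}"
    using False G by (intro holomorphic_countable_zeros holomorphic_deriv) 
       (use fsigma.intros[of "\<lambda>_. UNIV"] in auto)
  then show ?thesis by auto
qed

text \<open>
  Near a zero \<open>a\<close> of the divisor both functions are \<open>(z - a)\<close> times a holomorphic function,
  and the cofactor of the divisor is nonzero at \<open>a\<close> because the zero is simple.
\<close>

lemma holomorphic_quotient_simple_zeros:
  assumes f: "f holomorphic_on UNIV" and F: "F holomorphic_on UNIV"
    and simple: "\<And>z. F z = 0 \<Longrightarrow> deriv F z \<noteq> 0"
    and van: "\<And>z. F z = 0 \<Longrightarrow> f z = 0"
  obtains g where "g holomorphic_on UNIV" "\<And>z. f z = g z * F z"
proof -
  define g where "g = (\<lambda>z. if F z = 0 then deriv f z / deriv F z else f z / F z)"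
  have "g field_differentiable at a" for a
  proof (cases "F a = 0")
    case True
    define f1 where "f1 = (\<lambda>z. if z = a then deriv f a else (f z - f a) / (z - a))"
    define F1 where "F1 = (\<lambda>z. if z = a then deriv F a else (F z - F a) / (z - a))"
    have hol: "f1 holomorphic_on UNIV" "F1 holomorphic_on UNIV"
      unfolding f1_def F1_def by (intro pole_lemma_open f F open_UNIV)+
    have op: "open {z. F1 z \<noteq> 0}"
      using hol(2) by (intro open_Collect_neq continuous_intros holomorphic_on_imp_continuous_on)
    have a: "a \<in> {z. F1 z \<noteq> 0}" using simple True by (simp add: F1_def)
    have "(\<lambda>z. f1 z / F1 z) holomorphic_on {z. F1 z \<noteq> 0}"
      by (intro holomorphic_intros holomorphic_on_subset[OF hol(1)] holomorphic_on_subset[OF hol(2)]) auto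
    also have "?this \<longleftrightarrow> g holomorphic_on {z. F1 z \<noteq> 0}"
    proof (rule holomorphic_cong)
      fix z assume "z \<in> {z. F1 z \<noteq> 0}"
      then show "f1 z / F1 z = g z"
        using True van[OF True] by (auto simp: f1_def F1_def g_def)
    qed simp
    finally show ?thesis using op a by (auto simp: holomorphic_on_open field_differentiable_def)
  next
    case False
    have op: "open {z. F z \<noteq> 0}"
      using F by (intro open_Collect_neq continuous_intros holomorphic_on_imp_continuous_on)
    have "(\<lambda>z. f z / F z) holomorphic_on {z. F z \<noteq> 0}"
      by (intro holomorphic_intros holomorphic_on_subset[OF f] holomorphic_on_subset[OF F]) auto
    also have "?this \<longleftrightarrow> g holomorphic_on {z. F z \<noteq> 0}"
      by (intro holomorphic_cong) (auto simp: g_def)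
    finally show ?thesis using op False by (auto simp: holomorphic_on_open field_differentiable_def)
  qed
  then have "g holomorphic_on UNIV"
    by (simp add: holomorphic_on_def)
  moreover have "f z = g z * F z" for z
    using van[of z] by (auto simp: g_def)
  ultimately show ?thesis by (rule that)
qed

text \<open>
  The area sub-mean value inequality bounds the function by its total integral, so Liouville's
  theorem makes it constant, and a nonzero constant is not integrable over the plane.
\<close>

lemma entire_integrable_imp_zero:
  assumes g: "g holomorphic_on UNIV" and fin: "(\<integral>\<^sup>+z. ennreal (norm (g z)) \<partial>lborel) < \<infinity>"
  shows "g z = 0"
proof -
  define I where "I = (\<integral>\<^sup>+z. ennreal (norm (g z)) \<partial>lborel)"
  have [measurable]: "g \<in> borel_measurable borel"
    using g by (intro borel_measurable_continuous_onI holomorphic_on_imp_continuous_on)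
  have "norm (g z) \<le> enn2real I" for z
  proof -
    have "ennreal (norm (g z)) \<le> (\<integral>\<^sup>+w. ennreal (norm (g (z + w))) \<partial>lborel)"
      by (rule order.trans[OF norm_le_nn_integral_square[OF g]])
         (auto intro!: nn_integral_mono simp: indicator_def)
    also have "\<dots> = I"
      unfolding I_def by (subst (2) lborel_distr_plus[of z, symmetric]) (simp add: nn_integral_distr)
    also have "\<dots> = ennreal (enn2real I)" using fin by (simp add: I_def)
    finally show ?thesis by simp
  qed
  then have "bounded (range g)" by (auto simp: bounded_iff)
  then obtain c where c: "\<And>z. g z = c"
    using Liouville_theorem[OF g] by (auto simp: constant_on_def)
  have "ennreal (norm c) * \<infinity> < \<infinity>" using fin by (simp add: c)
  then show ?thesis by (simp add: c ennreal_mult_less_top)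
qed

section \<open>Gaussian power series for a fixed coefficient sequence\<close>

text \<open>
  A growth condition on coefficients that holds almost surely for normal variables, makes the
  Gaussian series entire, and survives the modification of a single coefficient. The last point
  is what allows one coefficient to be resampled while the others are kept.
\<close>

definition tame :: "(nat \<Rightarrow> complex) \<Rightarrow> bool" where
  "tame a \<longleftrightarrow> summable (\<lambda>n. norm (a n) / 2 ^ n)"

lemma tame_fun_upd:
  assumes "tame a"
  shows "tame (a(n := x))"
proof -
  have "summable (\<lambda>m. norm (a m) / 2 ^ m + (if m = n then norm x / 2 ^ n - norm (a n) / 2 ^ n else 0))"
    using assms unfolding tame_def by (intro summable_add summable_single)
  then show ?thesis
    unfolding tame_def by (rule back_subst[of summable]) auto
qed

definition gef_weight :: "real \<Rightarrow> nat \<Rightarrow> complex \<Rightarrow> complex" where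
  "gef_weight L n z = (of_real (sqrt L) * z) ^ n / of_real (sqrt (fact n))"

definition gef_coeff :: "real \<Rightarrow> (nat \<Rightarrow> complex) \<Rightarrow> nat \<Rightarrow> complex" where
  "gef_coeff L a n = a n * (of_real (sqrt L) ^ n / of_real (sqrt (fact n)))"

text \<open>
  The derivative of the Gaussian entire function as a termwise differentiated series: in this
  form it is visibly measurable in the coefficients and visibly independent of the constant one.
\<close>

definition gef_deriv :: "real \<Rightarrow> (nat \<Rightarrow> complex) \<Rightarrow> complex \<Rightarrow> complex" where
  "gef_deriv L a z = (\<Sum>n. diffs (gef_coeff L a) n * z ^ n)"

lemma power_over_fact_le_exp:
  assumes "0 \<le> (x::real)"
  shows "x ^ n / fact n \<le> exp x"
proof -
  have "(\<Sum>k\<in>{n}. x ^ k /\<^sub>R fact k) \<le> (\<Sum>k. x ^ k /\<^sub>R fact k)"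
    using assms by (intro sum_le_suminf summable_exp_generic) auto
  then show ?thesis by (simp add: exp_def divide_inverse mult.commute)
qed

lemma norm_gef_weight_power2:
  assumes "0 \<le> L"
  shows "(norm (gef_weight L n z))\<^sup>2 = (L * (norm z)\<^sup>2) ^ n / fact n"
proof -
  have sq: "(y ^ n)\<^sup>2 = (y\<^sup>2) ^ n" for y :: real
    by (simp only: power_mult[symmetric] mult.commute)
  show ?thesis
    using assms by (simp add: gef_weight_def norm_divide norm_power norm_mult power_divide power_mult_distrib sq)
qed

text \<open>
  The weight at \<open>z\<close> is \<open>2^-n\<close> times the weight at \<open>2 * z\<close>, and the weights at \<open>2 * z\<close> are bounded
  in \<open>n\<close>, so the series is dominated by the one in the definition of tameness.
\<close>

lemma summable_gef:
  assumes a: "tame a" and L: "0 \<le> L"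
  shows "summable (\<lambda>n. a n * gef_weight L n z)"
proof (rule summable_comparison_test')
  define K where "K = sqrt (exp (L * (norm (2 * z))\<^sup>2))"
  show "summable (\<lambda>n. norm (a n) / 2 ^ n * K)"
    using a unfolding tame_def by (rule summable_mult2)
  fix n :: nat
  have "(norm (gef_weight L n (2 * z)))\<^sup>2 \<le> exp (L * (norm (2 * z))\<^sup>2)"
    unfolding norm_gef_weight_power2[OF L] using L by (intro power_over_fact_le_exp) auto
  then have K: "norm (gef_weight L n (2 * z)) \<le> K"
    unfolding K_def by (rule real_le_rsqrt)
  have "norm (a n * gef_weight L n z) = norm (a n) / 2 ^ n * norm (gef_weight L n (2 * z))"
    by (simp add: gef_weight_def norm_mult norm_divide norm_power power_mult_distrib)
  also have "\<dots> \<le> norm (a n) / 2 ^ n * K"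
    using K by (intro mult_left_mono) auto
  finally show "norm (a n * gef_weight L n z) \<le> norm (a n) / 2 ^ n * K" .
qed

lemma gef_eq: "gef L a z = (\<Sum>n. a n * gef_weight L n z)"
  by (simp add: gef_def gef_weight_def)

lemma gef_coeff_power: "gef_coeff L a n * z ^ n = a n * gef_weight L n z"
  by (simp add: gef_coeff_def gef_weight_def power_mult_distrib)

lemma has_field_derivative_gef:
  assumes "tame a" "0 \<le> L"
  shows "(gef L a has_field_derivative gef_deriv L a z) (at z)"
  using termdiffs_strong_converges_everywhere[of "gef_coeff L a" z] summable_gef[OF assms]
  by (simp add: gef_coeff_power gef_deriv_def gef_eq[abs_def])

lemma holomorphic_gef:
  assumes "tame a" "0 \<le> L"
  shows "gef L a holomorphic_on UNIV" "gef_deriv L a = deriv (gef L a)"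
  using has_field_derivative_gef[OF assms]
  by (auto simp: holomorphic_on_open intro!: DERIV_imp_deriv[symmetric])

lemma gef_fun_upd:
  assumes "tame a" "0 \<le> L"
  shows "gef L (a(n := x)) z = x * gef_weight L n z + gef L (a(n := 0)) z"
proof -
  have "(\<lambda>m. (a(n := 0)) m * gef_weight L m z) sums gef L (a(n := 0)) z"
    unfolding gef_eq by (intro summable_sums summable_gef tame_fun_upd assms)
  moreover have "(\<lambda>m. if m = n then x * gef_weight L m z else 0) sums (x * gef_weight L n z)"
    by (rule sums_single)
  ultimately have "(\<lambda>m. (if m = n then x * gef_weight L m z else 0) + (a(n := 0)) m * gef_weight L m z)
      sums (x * gef_weight L n z + gef L (a(n := 0)) z)"
    by (intro sums_add)
  also have "(\<lambda>m. (if m = n then x * gef_weight L m z else 0) + (a(n := 0)) m * gef_weight L m z)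
      = (\<lambda>m. (a(n := x)) m * gef_weight L m z)" by auto
  finally show ?thesis unfolding gef_eq[of L "a(n := x)"] by (rule sums_unique[symmetric])
qed

lemma gef_deriv_fun_upd_0: "gef_deriv L (a(0 := x)) = gef_deriv L a"
  by (simp add: gef_deriv_def[abs_def] diffs_def gef_coeff_def)

text \<open>
  The squared weights are the terms of the series of \<open>exp x\<close> for \<open>x = L * |z|^2\<close>. One term is
  nearly as large as the sum: if all terms were below \<open>K\<close>, then weighting them with \<open>q^n\<close> for a
  \<open>q < 1\<close> would give \<open>exp (q * x) \<le> K / (1 - q)\<close>. The choice of \<open>q\<close> turns \<open>q * x\<close> into
  \<open>(1 + L) / 2 * |z|^2\<close>, whose rate lies strictly between those of the Fock weight and of the
  Gaussian entire function.
\<close>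

lemma exists_large_gef_weight:
  assumes "1 < L"
  shows "\<exists>n. sqrt ((L - 1) / (4 * L)) * exp ((1 + L) / 2 * (norm z)\<^sup>2 / 2) \<le> norm (gef_weight L n z)"
proof (rule ccontr)
  define q where "q = (1 + L) / (2 * L)"
  define x where "x = L * (norm z)\<^sup>2"
  have q: "0 < q" "q < 1" using assms by (auto simp: q_def field_simps)
  have qx: "(1 + L) / 2 * (norm z)\<^sup>2 = q * x" using assms by (simp add: q_def x_def)
  have c: "(L - 1) / (4 * L) = (1 - q) / 2" using assms by (simp add: q_def field_simps)
  have x0: "0 \<le> x" using assms by (simp add: x_def)
  assume *: "\<not> ?thesis"
  have le: "x ^ n / fact n \<le> (1 - q) / 2 * exp (q * x)" for n
  proof -
    have "norm (gef_weight L n z) \<le> sqrt ((1 - q) / 2) * exp (q * x / 2)"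
      using * unfolding qx c by (auto simp: not_le intro: less_imp_le)
    then have "(norm (gef_weight L n z))\<^sup>2 \<le> (sqrt ((1 - q) / 2) * exp (q * x / 2))\<^sup>2"
      by (rule power_mono) simp
    also have "\<dots> = (1 - q) / 2 * exp (q * x)"
      using q by (simp add: power_mult_distrib exp_double[symmetric])
    finally show ?thesis using assms by (simp add: norm_gef_weight_power2 x_def)
  qed
  have s1: "(\<lambda>n. (q * x) ^ n /\<^sub>R fact n) sums exp (q * x)"
    unfolding exp_def by (intro summable_sums summable_exp_generic)
  have s2: "(\<lambda>n. (1 - q) / 2 * exp (q * x) * q ^ n) sums ((1 - q) / 2 * exp (q * x) * (1 / (1 - q)))"
    using q by (intro sums_mult geometric_sums) auto
  have le2: "(q * x) ^ n /\<^sub>R fact n \<le> (1 - q) / 2 * exp (q * x) * q ^ n" for n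
  proof -
    have "(q * x) ^ n /\<^sub>R fact n = x ^ n / fact n * q ^ n"
      by (simp add: power_mult_distrib divide_inverse)
    also have "\<dots> \<le> (1 - q) / 2 * exp (q * x) * q ^ n"
      using q by (intro mult_right_mono le) auto
    finally show ?thesis .
  qed
  have "exp (q * x) \<le> (1 - q) / 2 * exp (q * x) * (1 / (1 - q))"
    by (rule sums_le[OF le2 s1 s2])
  also have "\<dots> = exp (q * x) / 2" using q by (simp add: field_simps)
  finally show False by simp
qed

section \<open>Detecting double zeros through countably many points\<close>

text \<open>
  The existence of a double zero in the disc of radius \<open>N\<close> involves uncountably many points.
  For tame coefficients and a countable dense set \<open>D\<close> the condition below expresses, up to points on the boundary
  circle, the same event through countably many points, so that it is visibly measurable.
\<close>

definition near_double_zero :: "complex set \<Rightarrow> real \<Rightarrow> nat \<Rightarrow> (nat \<Rightarrow> complex) \<Rightarrow> bool" where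
  "near_double_zero D L N a \<longleftrightarrow>
     (\<forall>k::nat. \<exists>z\<in>D. norm z < N \<and> norm (gef L a z) + norm (gef_deriv L a z) < 1 / Suc k)"

lemma measurable_gef [measurable (raw)]:
  assumes [measurable]: "\<And>n. (\<lambda>x. a x n) \<in> borel_measurable M" "g \<in> borel_measurable M"
  shows "(\<lambda>x. gef L (a x) (g x)) \<in> borel_measurable M"
  unfolding gef_def by measurable

lemma measurable_gef_deriv [measurable (raw)]:
  assumes [measurable]: "\<And>n. (\<lambda>x. a x n) \<in> borel_measurable M" "g \<in> borel_measurable M"
  shows "(\<lambda>x. gef_deriv L (a x) (g x)) \<in> borel_measurable M"
  unfolding gef_deriv_def diffs_def gef_coeff_def by measurable

lemma measurable_near_double_zero:
  assumes "countable D"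
  shows "Measurable.pred (\<Pi>\<^sub>M i\<in>UNIV. borel) (near_double_zero D L N)"
  unfolding near_double_zero_def[abs_def]
  unfolding pred_def
  by (rule sets.sets_Collect_countable_All, rule sets.sets_Collect_countable_Ex'[OF _ assms]) measurable

lemma continuous_gef_norms:
  assumes "tame a" "0 \<le> L"
  shows "continuous_on A (\<lambda>z. norm (gef L a z) + norm (gef_deriv L a z))"
  unfolding holomorphic_gef(2)[OF assms]
  by (intro continuous_intros holomorphic_on_imp_continuous_on holomorphic_on_subset[OF holomorphic_gef(1)[OF assms]]
        holomorphic_on_subset[OF holomorphic_deriv[OF holomorphic_gef(1)[OF assms] open_UNIV]]) auto

lemma near_double_zeroI:
  assumes "tame a" "0 \<le> L" "gef L a z = 0" "gef_deriv L a z = 0" "norm z < N"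
    and D: "\<And>X. open X \<Longrightarrow> X \<noteq> {} \<Longrightarrow> \<exists>d\<in>D. d \<in> X"
  shows "near_double_zero D L N a"
  unfolding near_double_zero_def
proof
  fix k :: nat
  let ?X = "{w. norm w < N} \<inter> {w. norm (gef L a w) + norm (gef_deriv L a w) < 1 / Suc k}"
  have "open ?X"
    by (intro open_Int open_Collect_less continuous_intros continuous_gef_norms assms)
  moreover have "z \<in> ?X" using assms by simp
  ultimately show "\<exists>w\<in>D. norm w < N \<and> norm (gef L a w) + norm (gef_deriv L a w) < 1 / Suc k"
    using D[of ?X] by blast
qed

text \<open>
  On the closed disc the continuous function \<open>|F| + |F'|\<close> attains its infimum, which is zero.
\<close>

lemma near_double_zeroD:
  assumes "tame a" "0 \<le> L" "near_double_zero D L N a"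
  shows "\<exists>z. gef L a z = 0 \<and> gef_deriv L a z = 0"
proof -
  let ?h = "\<lambda>z. norm (gef L a z) + norm (gef_deriv L a z)"
  have "\<exists>z\<in>cball 0 (real N). \<forall>y\<in>cball 0 (real N). ?h z \<le> ?h y"
    by (intro continuous_attains_inf continuous_gef_norms assms) auto
  then obtain z where "\<forall>y\<in>cball 0 (real N). ?h z \<le> ?h y" by blast
  then have z: "?h z \<le> ?h y" if "norm y \<le> N" for y using that by simp
  have "?h z \<le> 0"
  proof (rule ccontr)
    assume "\<not> ?h z \<le> 0"
    then obtain k :: nat where k: "1 / Suc k < ?h z"
      using reals_Archimedean[of "?h z"] by (auto simp: inverse_eq_divide not_le)
    from assms(3) obtain y where "norm y < N" "?h y < 1 / Suc k"
      unfolding near_double_zero_def by blast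
    with k z[of y] show False by simp
  qed
  then show ?thesis by (intro exI[of _ z]) (smt (verit) norm_ge_zero norm_eq_zero)
qed

section \<open>Almost sure properties of the Gaussian entire function\<close>

context prob_space
begin

text \<open>
  Since \<open>\<zeta> n\<close> is independent of the other coefficients, integrating over the probability space
  does not change when \<open>\<zeta> n\<close> is replaced by an integration variable distributed by the complex
  normal density. The inner integral can then be estimated for fixed values of the remaining
  coefficients.
\<close>

lemma nn_integral_resample:
  fixes \<zeta> :: "nat \<Rightarrow> 'a \<Rightarrow> complex"
  assumes iid: "iid_std_complex_normal M \<zeta>"
    and h [measurable]: "h \<in> borel_measurable (\<Pi>\<^sub>M i\<in>UNIV. borel)"
  shows "(\<integral>\<^sup>+\<omega>. h (\<lambda>m. \<zeta> m \<omega>) \<partial>M) =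
    (\<integral>\<^sup>+\<omega>. \<integral>\<^sup>+x. ennreal (std_complex_normal_density x) * h ((\<lambda>m. \<zeta> m \<omega>)(n := x)) \<partial>lborel \<partial>M)"
proof -
  let ?J = "UNIV - {n}"
  let ?P = "Pi\<^sub>M ?J (\<lambda>_. borel :: complex measure)"
  define Y where "Y = (\<lambda>\<omega>. restrict (\<lambda>m. \<zeta> m \<omega>) ?J)"
  have ind: "indep_vars (\<lambda>_. borel) \<zeta> UNIV" and dist: "distributed M lborel (\<zeta> n) std_complex_normal_density"
    using iid by (auto simp: iid_std_complex_normal_def)
  have rv [measurable]: "\<zeta> m \<in> borel_measurable M" for m
    using ind by (auto simp: indep_vars_def)
  have Y [measurable]: "Y \<in> measurable M ?P" unfolding Y_def by measurable
  \<comment> \<open>\<open>X\<close> is the \<open>n\<close>-th coefficient, kept as a function on \<open>{n}\<close> since both members of an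
    independent pair must have the same type.\<close>
  define X where "X = (\<lambda>\<omega>. restrict (\<lambda>m. \<zeta> m \<omega>) {n})"
  let ?R = "Pi\<^sub>M {n} (\<lambda>_. borel :: complex measure)"
  have X [measurable]: "X \<in> measurable M ?R" unfolding X_def by measurable
  have iv: "indep_var ?R X ?P Y"
    unfolding X_def Y_def by (rule indep_var_restrict[OF ind]) auto
  define k where "k = (\<lambda>(x, y). h (y(n := x)))"
  have "(\<lambda>p. (fst p)(n := snd p)) \<in> measurable (?P \<Otimes>\<^sub>M borel) (Pi\<^sub>M (insert n ?J) (\<lambda>_. borel))"
    using measurable_add_dim[of n ?J "\<lambda>_. borel :: complex measure"] by (simp add: case_prod_beta')
  moreover have "insert n ?J = UNIV" by auto
  ultimately have add: "(\<lambda>p. (fst p)(n := snd p)) \<in> measurable (?P \<Otimes>\<^sub>M borel) (\<Pi>\<^sub>M i\<in>UNIV. borel)"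
    by simp
  have "(\<lambda>p. (snd p)(n := fst p)) \<in> measurable (borel \<Otimes>\<^sub>M ?P) (\<Pi>\<^sub>M i\<in>UNIV. borel)"
    using measurable_compose[OF measurable_pair_swap' add] by (simp add: case_prod_beta')
  from measurable_compose[OF this h] have k [measurable]: "k \<in> borel_measurable (borel \<Otimes>\<^sub>M ?P)"
    unfolding k_def case_prod_beta' by simp
  have kY: "k (x, Y \<omega>) = h ((\<lambda>m. \<zeta> m \<omega>)(n := x))" for x \<omega>
  proof -
    have "(Y \<omega>)(n := x) = (\<lambda>m. \<zeta> m \<omega>)(n := x)" by (auto simp: Y_def)
    then show ?thesis by (simp add: k_def)
  qed
  interpret X: prob_space "distr M ?R X" by (rule prob_space_distr) simp
  interpret Yp: prob_space "distr M ?P Y" by (rule prob_space_distr) simp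
  interpret XY: pair_sigma_finite "distr M ?R X" "distr M ?P Y" ..
  have "(\<integral>\<^sup>+\<omega>. h (\<lambda>m. \<zeta> m \<omega>) \<partial>M) = (\<integral>\<^sup>+\<omega>. k (X \<omega> n, Y \<omega>) \<partial>M)"
  proof -
    have "(\<lambda>m. \<zeta> m \<omega>)(n := \<zeta> n \<omega>) = (\<lambda>m. \<zeta> m \<omega>)" for \<omega> by auto
    then show ?thesis by (simp add: kY X_def)
  qed
  also have "\<dots> = (\<integral>\<^sup>+p. k (fst p n, snd p) \<partial>distr M (?R \<Otimes>\<^sub>M ?P) (\<lambda>\<omega>. (X \<omega>, Y \<omega>)))"
    by (subst nn_integral_distr) auto
  also have "\<dots> = (\<integral>\<^sup>+p. k (fst p n, snd p) \<partial>(distr M ?R X \<Otimes>\<^sub>M distr M ?P Y))"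
    using iv unfolding indep_var_distribution_eq by simp
  also have "\<dots> = (\<integral>\<^sup>+y. \<integral>\<^sup>+x. k (x n, y) \<partial>distr M ?R X \<partial>distr M ?P Y)"
    by (subst XY.nn_integral_snd[symmetric]) auto
  also have "\<dots> = (\<integral>\<^sup>+y. \<integral>\<^sup>+x. ennreal (std_complex_normal_density x) * k (x, y) \<partial>lborel \<partial>distr M ?P Y)"
  proof (rule nn_integral_cong)
    fix y assume y: "y \<in> space (distr M ?P Y)"
    then have [measurable]: "(\<lambda>x. k (x, y)) \<in> borel_measurable borel"
      using measurable_compose[OF measurable_Pair2' k, of y] by simp
    have "(\<integral>\<^sup>+x. k (x n, y) \<partial>distr M ?R X) = (\<integral>\<^sup>+\<omega>. k (\<zeta> n \<omega>, y) \<partial>M)"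
      by (subst nn_integral_distr) (auto simp: X_def)
    also have "\<dots> = (\<integral>\<^sup>+x. ennreal (std_complex_normal_density x) * k (x, y) \<partial>lborel)"
      by (subst distributed_nn_integral[OF dist]) auto
    finally show "(\<integral>\<^sup>+x. k (x n, y) \<partial>distr M ?R X) = \<dots>" .
  qed
  also have "\<dots> = (\<integral>\<^sup>+\<omega>. \<integral>\<^sup>+x. ennreal (std_complex_normal_density x) * k (x, Y \<omega>) \<partial>lborel \<partial>M)"
    by (subst nn_integral_distr) auto
  finally show ?thesis by (simp add: kY)
qed

text \<open>
  The expectation of \<open>|\<zeta> n|\<close> is bounded independently of \<open>n\<close>, so the series defining tameness
  has finite expectation.
\<close>

lemma AE_tame:
  assumes iid: "iid_std_complex_normal M \<zeta>"
  shows "AE \<omega> in M. tame (\<lambda>n. \<zeta> n \<omega>)"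
proof -
  have dist: "\<And>n. distributed M lborel (\<zeta> n) std_complex_normal_density"
    using iid by (auto simp: iid_std_complex_normal_def)
  have rv [measurable]: "\<zeta> m \<in> borel_measurable M" for m
    using distributed_measurable[OF dist[of m]] by simp
  define K where "K = (\<integral>\<^sup>+z. ennreal (exp (- (1/2) * (norm (z::complex))\<^sup>2)) \<partial>lborel)"
  have K: "K < \<infinity>" unfolding K_def by (rule nn_integral_gaussian_complex_finite) simp
  have E: "(\<integral>\<^sup>+\<omega>. ennreal (norm (\<zeta> n \<omega>)) \<partial>M) \<le> K" for n
  proof -
    have "(\<integral>\<^sup>+\<omega>. ennreal (norm (\<zeta> n \<omega>)) \<partial>M)
        = (\<integral>\<^sup>+z. ennreal (std_complex_normal_density z) * ennreal (norm z) \<partial>lborel)"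
      by (subst distributed_nn_integral[OF dist[of n]]) auto
    also have "\<dots> \<le> K" unfolding K_def
    proof (rule nn_integral_mono)
      fix z :: complex
      have "norm z \<le> 1 + (norm z)\<^sup>2 / 2"
        using zero_le_power2[of "norm z - 1"] by (simp add: power2_eq_square algebra_simps)
      also have "\<dots> \<le> exp ((norm z)\<^sup>2 / 2)" by (rule exp_ge_add_one_self)
      finally have "exp (- (norm z)\<^sup>2) * norm z \<le> exp (- (norm z)\<^sup>2) * exp ((norm z)\<^sup>2 / 2)"
        by (rule mult_left_mono) simp
      also have "\<dots> = exp (- (1/2) * (norm z)\<^sup>2)" by (simp flip: exp_add)
      finally have "exp (- (norm z)\<^sup>2) * norm z \<le> exp (- (1/2) * (norm z)\<^sup>2)" .
      moreover have "std_complex_normal_density z * norm z \<le> exp (- (norm z)\<^sup>2) * norm z"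
        using pi_gt3 unfolding std_complex_normal_density_def
        by (intro mult_right_mono) (auto simp: divide_le_eq)
      ultimately show "ennreal (std_complex_normal_density z) * ennreal (norm z)
          \<le> ennreal (exp (- (1/2) * (norm z)\<^sup>2))"
        by (subst ennreal_mult[symmetric]) (auto simp: std_complex_normal_density_def intro!: ennreal_leI)
    qed
    finally show ?thesis .
  qed
  have "(\<integral>\<^sup>+\<omega>. (\<Sum>n. ennreal (norm (\<zeta> n \<omega>) / 2 ^ n)) \<partial>M)
      = (\<Sum>n. \<integral>\<^sup>+\<omega>. ennreal (norm (\<zeta> n \<omega>) / 2 ^ n) \<partial>M)"
    by (rule nn_integral_suminf) measurable
  also have "\<dots> \<le> (\<Sum>n. K * ennreal ((1/2) ^ n))"
  proof (intro suminf_le)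
    fix n
    have "(\<integral>\<^sup>+\<omega>. ennreal (norm (\<zeta> n \<omega>) / 2 ^ n) \<partial>M)
        = (\<integral>\<^sup>+\<omega>. ennreal (norm (\<zeta> n \<omega>)) * ennreal ((1/2) ^ n) \<partial>M)"
      by (simp add: power_divide flip: ennreal_mult)
    also have "\<dots> \<le> K * ennreal ((1/2) ^ n)"
      using E[of n] by (subst nn_integral_multc) (auto intro: mult_right_mono)
    finally show "(\<integral>\<^sup>+\<omega>. ennreal (norm (\<zeta> n \<omega>) / 2 ^ n) \<partial>M) \<le> K * ennreal ((1/2) ^ n)" .
  qed auto
  also have "\<dots> = K * (\<Sum>n. ennreal ((1/2) ^ n))" by simp
  also have "(\<Sum>n. ennreal ((1/2) ^ n)) = ennreal 2"
    using geometric_sums[of "1/2::real"] by (intro suminf_ennreal_eq) auto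
  also have "K * ennreal 2 < \<infinity>" using K by (simp add: ennreal_mult_less_top)
  finally have "AE \<omega> in M. (\<Sum>n. ennreal (norm (\<zeta> n \<omega>) / 2 ^ n)) \<noteq> \<infinity>"
    by (intro nn_integral_PInf_AE) auto
  then show ?thesis
    by eventually_elim (auto simp: tame_def intro!: summable_suminf_not_top)
qed

text \<open>
  Resample the constant coefficient: with \<open>F = x + G\<close>, a double zero of \<open>F\<close> is a critical point of
  \<open>G\<close> at which \<open>G\<close> takes the value \<open>- x\<close>. So \<open>x\<close> lies in the countable set of negated critical
  values of \<open>G\<close>, which the normal law does not charge.
\<close>

lemma AE_no_double_zero:
  assumes iid: "iid_std_complex_normal M \<zeta>" and L: "0 \<le> L"
  shows "AE \<omega> in M. \<forall>z. gef L (\<lambda>n. \<zeta> n \<omega>) z = 0 \<longrightarrow> gef_deriv L (\<lambda>n. \<zeta> n \<omega>) z \<noteq> 0"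
proof -
  have dist: "\<And>n. distributed M lborel (\<zeta> n) std_complex_normal_density"
    using iid by (auto simp: iid_std_complex_normal_def)
  have rv [measurable]: "\<zeta> m \<in> borel_measurable M" for m
    using distributed_measurable[OF dist[of m]] by simp
  obtain D :: "complex set" where D: "countable D" "\<And>X. open X \<Longrightarrow> X \<noteq> {} \<Longrightarrow> \<exists>d\<in>D. d \<in> X"
    using countable_dense_exists by blast
  have "AE \<omega> in M. \<not> near_double_zero D L N (\<lambda>n. \<zeta> n \<omega>)" for N
  proof -
    define h where "h = (\<lambda>a. indicator {a. near_double_zero D L N a} a :: ennreal)"
    have h [measurable]: "h \<in> borel_measurable (\<Pi>\<^sub>M i\<in>UNIV. borel)"
      using measurable_near_double_zero[OF D(1), of L N]
      unfolding h_def by (auto simp: pred_def space_PiM)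
    have "(\<lambda>\<omega>. \<lambda>m\<in>UNIV. \<zeta> m \<omega>) \<in> measurable M (\<Pi>\<^sub>M i\<in>UNIV. borel)"
      by measurable
    then have [measurable]: "(\<lambda>\<omega>. h (\<lambda>m. \<zeta> m \<omega>)) \<in> borel_measurable M"
      by (intro measurable_compose[OF _ h]) (simp add: restrict_UNIV)
    have "(\<integral>\<^sup>+\<omega>. h (\<lambda>m. \<zeta> m \<omega>) \<partial>M) =
      (\<integral>\<^sup>+\<omega>. \<integral>\<^sup>+x. ennreal (std_complex_normal_density x) * h ((\<lambda>m. \<zeta> m \<omega>)(0 := x)) \<partial>lborel \<partial>M)"
      by (rule nn_integral_resample[OF iid h])
    also have "\<dots> = (\<integral>\<^sup>+\<omega>. 0 \<partial>M)"
    proof (rule nn_integral_cong_AE)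
      show "AE \<omega> in M. (\<integral>\<^sup>+x. ennreal (std_complex_normal_density x) * h ((\<lambda>m. \<zeta> m \<omega>)(0 := x)) \<partial>lborel) = 0"
        using AE_tame[OF iid]
      proof eventually_elim
        case (elim \<omega>)
        let ?a = "\<lambda>m. \<zeta> m \<omega>"
        let ?G = "gef L (?a(0 := 0))"
        let ?C = "uminus ` ?G ` {z. deriv ?G z = 0}"
        have t: "tame (?a(0 := x))" for x using elim by (rule tame_fun_upd)
        have C: "countable ?C"
          by (intro countable_image countable_critical_values holomorphic_gef t L)
        have "h (?a(0 := x)) = 0" if x: "x \<notin> ?C" for x
        proof (rule ccontr)
          assume "h (?a(0 := x)) \<noteq> 0"
          then have "near_double_zero D L N (?a(0 := x))" by (auto simp: h_def split: split_indicator_asm)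
          from near_double_zeroD[OF t L this] obtain z
            where z: "gef L (?a(0 := x)) z = 0" "gef_deriv L (?a(0 := x)) z = 0" by auto
          have "x + ?G z = 0"
            using z(1) gef_fun_upd[OF elim L, of 0 x z] by (simp add: gef_weight_def)
          then have "x = - ?G z" by (simp add: add_eq_0_iff2)
          moreover have "deriv ?G z = 0"
            using z(2) holomorphic_gef(2)[OF t L, of 0] by (simp add: gef_deriv_fun_upd_0)
          ultimately show False using x by auto
        qed
        then have "AE x in lborel. h (?a(0 := x)) = 0"
          using AE_not_in[OF countable_imp_null_set_lborel[OF C]] by (auto elim!: eventually_mono)
        then have "AE x in lborel. ennreal (std_complex_normal_density x) * h (?a(0 := x)) = 0"
          by eventually_elim simp
        then show ?case by (subst nn_integral_cong_AE) auto
      qed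
    qed
    finally have "(\<integral>\<^sup>+\<omega>. h (\<lambda>m. \<zeta> m \<omega>) \<partial>M) = 0" by simp
    then have "AE \<omega> in M. h (\<lambda>m. \<zeta> m \<omega>) = 0"
      by (subst (asm) nn_integral_0_iff_AE) auto
    then show ?thesis by eventually_elim (auto simp: h_def)
  qed
  then have "AE \<omega> in M. \<forall>N. \<not> near_double_zero D L N (\<lambda>n. \<zeta> n \<omega>)"
    by (simp add: AE_all_countable)
  then show ?thesis using AE_tame[OF iid]
  proof eventually_elim
    case (elim \<omega>)
    show ?case
    proof (intro allI impI notI)
      fix z assume "gef L (\<lambda>n. \<zeta> n \<omega>) z = 0" "gef_deriv L (\<lambda>n. \<zeta> n \<omega>) z = 0"
      moreover obtain N where "norm z < real N" using reals_Archimedean2 by blast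
      ultimately have "near_double_zero D L N (\<lambda>n. \<zeta> n \<omega>)"
        using elim(2) L D(2) by (intro near_double_zeroI)
      then show False using elim(1) by blast
    qed
  qed
qed

text \<open>
  Resample the \<open>n\<close>-th coefficient; as a function of it the Gaussian entire function is affine
  with slope \<open>gef_weight L n w\<close>.
\<close>

lemma nn_integral_inverse_gef_le:
  assumes iid: "iid_std_complex_normal M \<zeta>" and L: "0 \<le> L" and w: "gef_weight L n w \<noteq> 0"
  shows "(\<integral>\<^sup>+\<omega>. ennreal (1 / norm (gef L (\<lambda>n. \<zeta> n \<omega>) w)) \<partial>M) \<le> ennreal (17 / norm (gef_weight L n w))"
proof -
  have "(\<integral>\<^sup>+\<omega>. ennreal (1 / norm (gef L (\<lambda>n. \<zeta> n \<omega>) w)) \<partial>M)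
    = (\<integral>\<^sup>+\<omega>. \<integral>\<^sup>+x. ennreal (std_complex_normal_density x) *
          ennreal (1 / norm (gef L ((\<lambda>m. \<zeta> m \<omega>)(n := x)) w)) \<partial>lborel \<partial>M)"
    by (rule nn_integral_resample[OF iid]) measurable
  also have "\<dots> \<le> (\<integral>\<^sup>+\<omega>. ennreal (17 / norm (gef_weight L n w)) \<partial>M)"
  proof (rule nn_integral_mono_AE)
    show "AE \<omega> in M. (\<integral>\<^sup>+x. ennreal (std_complex_normal_density x) *
          ennreal (1 / norm (gef L ((\<lambda>m. \<zeta> m \<omega>)(n := x)) w)) \<partial>lborel)
        \<le> ennreal (17 / norm (gef_weight L n w))"
      using AE_tame[OF iid]
    proof eventually_elim
      case (elim \<omega>)
      define b where "b = gef L ((\<lambda>m. \<zeta> m \<omega>)(n := 0)) w"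
      have "gef L ((\<lambda>m. \<zeta> m \<omega>)(n := x)) w = x * gef_weight L n w + b" for x
        unfolding b_def by (rule gef_fun_upd[OF elim L])
      then show ?case
        using nn_integral_normal_inverse_norm_affine[OF w, of b] by simp
    qed
  qed
  finally show ?thesis by (simp add: emeasure_space_1)
qed

text \<open>
  The quantitative heart of the argument. At a fixed \<open>w\<close> the expectation of \<open>1 / |F w|\<close> is at most a
  constant times \<open>exp (- (1 + L) / 2 * |w|^2 / 2)\<close>, which for \<open>L > 1\<close> beats the weight by
  a Gaussian factor. Tonelli's theorem then gives a finite expectation to the area integral.
\<close>

lemma AE_weighted_inverse_gef_integrable:
  assumes iid: "iid_std_complex_normal M \<zeta>" and L: "1 < L"
  shows "AE \<omega> in M. (\<integral>\<^sup>+w. ennreal (exp ((norm w + 3)\<^sup>2 / 2)) *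
            ennreal (1 / norm (gef L (\<lambda>n. \<zeta> n \<omega>) w)) \<partial>lborel) < \<infinity>"
proof -
  have rv [measurable]: "\<zeta> m \<in> borel_measurable M" for m
    using iid by (auto simp: iid_std_complex_normal_def indep_vars_def)
  define c where "c = sqrt ((L - 1) / (4 * L))"
  have c: "c > 0" using L by (simp add: c_def)
  define d where "d = (L - 1) / 8"
  have d: "d > 0" using L by (simp add: d_def)
  define A where "A = 9 / 2 + 9 / (4 * d)"
  let ?I = "\<lambda>\<omega> w. ennreal (exp ((norm w + 3)\<^sup>2 / 2)) * ennreal (1 / norm (gef L (\<lambda>n. \<zeta> n \<omega>) w))"
  interpret P: pair_sigma_finite lborel M ..
  \<comment> \<open>The linear term \<open>3 * |w|\<close> in the exponent is absorbed by half of the quadratic gain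
    \<open>2 * d * |w|^2\<close>, at the price of the constant \<open>A\<close>.\<close>
  have pw: "(\<integral>\<^sup>+\<omega>. ?I \<omega> w \<partial>M) \<le> ennreal (17 / c * exp A) * ennreal (exp (- d * (norm w)\<^sup>2))" for w :: complex
  proof -
    define r where "r = norm w"
    obtain n where n: "c * exp ((1 + L) / 2 * r\<^sup>2 / 2) \<le> norm (gef_weight L n w)"
      using exists_large_gef_weight[OF L, of w] by (auto simp: c_def r_def)
    moreover have "0 < c * exp ((1 + L) / 2 * r\<^sup>2 / 2)" using c by simp
    ultimately have nz: "0 < norm (gef_weight L n w)" by linarith
    have "0 \<le> (2 * d * r - 3)\<^sup>2 / (4 * d)" using d by simp
    also have "\<dots> = d * r\<^sup>2 - 3 * r + 9 / (4 * d)"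
      using d by (simp add: power2_eq_square field_simps)
    finally have "3 * r \<le> d * r\<^sup>2 + 9 / (4 * d)" by simp
    moreover have "(r + 3)\<^sup>2 / 2 = r\<^sup>2 / 2 + 3 * r + 9 / 2"
      by (simp add: power2_eq_square field_simps)
    moreover have "(1 + L) / 2 * r\<^sup>2 / 2 = r\<^sup>2 / 2 + 2 * (d * r\<^sup>2)"
      by (simp add: d_def field_simps)
    ultimately have ex: "(r + 3)\<^sup>2 / 2 \<le> A + - d * r\<^sup>2 + (1 + L) / 2 * r\<^sup>2 / 2"
      unfolding A_def by linarith
    have "17 / norm (gef_weight L n w) \<le> 17 / (c * exp ((1 + L) / 2 * r\<^sup>2 / 2))"
      using n c nz by (intro divide_left_mono) auto
    then have "exp ((r + 3)\<^sup>2 / 2) * (17 / norm (gef_weight L n w))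
       \<le> exp (A + - d * r\<^sup>2 + (1 + L) / 2 * r\<^sup>2 / 2) * (17 / (c * exp ((1 + L) / 2 * r\<^sup>2 / 2)))"
      using ex by (intro mult_mono) auto
    also have "\<dots> = 17 / c * exp A * exp (- d * r\<^sup>2)"
      unfolding exp_add using c by simp
    finally have fin: "exp ((r + 3)\<^sup>2 / 2) * (17 / norm (gef_weight L n w)) \<le> 17 / c * exp A * exp (- d * r\<^sup>2)" .
    have "(\<integral>\<^sup>+\<omega>. ?I \<omega> w \<partial>M) = ennreal (exp ((r + 3)\<^sup>2 / 2)) * (\<integral>\<^sup>+\<omega>. ennreal (1 / norm (gef L (\<lambda>n. \<zeta> n \<omega>) w)) \<partial>M)"
      unfolding r_def by (rule nn_integral_cmult) measurable
    also have "\<dots> \<le> ennreal (exp ((r + 3)\<^sup>2 / 2)) * ennreal (17 / norm (gef_weight L n w))"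
      using nz L by (intro mult_left_mono nn_integral_inverse_gef_le[OF iid]) auto
    also have "\<dots> \<le> ennreal (17 / c * exp A * exp (- d * r\<^sup>2))"
      using fin by (subst ennreal_mult[symmetric]) (auto intro: ennreal_leI)
    also have "\<dots> = ennreal (17 / c * exp A) * ennreal (exp (- d * (norm w)\<^sup>2))"
      unfolding r_def using c by (intro ennreal_mult) auto
    finally show ?thesis .
  qed
  have [measurable]: "(\<lambda>(w, \<omega>). ?I \<omega> w) \<in> borel_measurable (lborel \<Otimes>\<^sub>M M)"
    unfolding case_prod_beta' by measurable
  have "(\<integral>\<^sup>+\<omega>. \<integral>\<^sup>+w. ?I \<omega> w \<partial>lborel \<partial>M) = (\<integral>\<^sup>+w. \<integral>\<^sup>+\<omega>. ?I \<omega> w \<partial>M \<partial>lborel)"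
    by (rule P.Fubini') measurable
  also have "\<dots> \<le> (\<integral>\<^sup>+w. ennreal (17 / c * exp A) * ennreal (exp (- d * (norm (w::complex))\<^sup>2)) \<partial>lborel)"
    by (intro nn_integral_mono pw)
  also have "\<dots> = ennreal (17 / c * exp A) * (\<integral>\<^sup>+w. ennreal (exp (- d * (norm (w::complex))\<^sup>2)) \<partial>lborel)"
    by (rule nn_integral_cmult) measurable
  also have "\<dots> < \<infinity>"
    using nn_integral_gaussian_complex_finite[OF d] by (simp add: ennreal_mult_less_top)
  finally have "AE \<omega> in M. (\<integral>\<^sup>+w. ?I \<omega> w \<partial>lborel) \<noteq> \<infinity>"
    by (intro nn_integral_PInf_AE) auto
  then show ?thesis by eventually_elim (simp add: less_top)
qed

end

section \<open>Zero sets of Gaussian entire functions as uniqueness sets\<close>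

theorem corollary1p3:
  fixes M :: "'w measure" and \<zeta> :: "nat \<Rightarrow> 'w \<Rightarrow> complex" and L p :: real
  assumes "prob_space M"
    and "iid_std_complex_normal M \<zeta>"
    and "1 < L"
    and "1 \<le> p"
  shows "AE \<omega> in M.
    {f \<in> fock_space p. \<forall>z \<in> gef_zeros L (\<lambda>n. \<zeta> n \<omega>). f z = 0} = {\<lambda>_. 0}"
proof -
  interpret prob_space M by fact
  note iid = assms(2)
  have L: "0 \<le> L" using assms(3) by simp
  show ?thesis
    using AE_tame[OF iid] AE_no_double_zero[OF iid L] AE_weighted_inverse_gef_integrable[OF iid assms(3)]
  proof eventually_elim
    case (elim \<omega>)
    define F where "F = gef L (\<lambda>n. \<zeta> n \<omega>)"
    have F: "F holomorphic_on UNIV" and simple: "\<And>z. F z = 0 \<Longrightarrow> deriv F z \<noteq> 0"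
      using elim holomorphic_gef[OF elim(1) L] by (auto simp: F_def)
    have [measurable]: "F \<in> borel_measurable borel"
      using F by (intro borel_measurable_continuous_onI holomorphic_on_imp_continuous_on)
    \<comment> \<open>A constant \<open>F\<close> cannot vanish: its zeros would be multiple.\<close>
    have "countable {z. F z = 0}"
    proof (cases "F constant_on UNIV")
      case True
      then obtain c where c: "F = (\<lambda>_. c)" by (auto simp: constant_on_def)
      then show ?thesis using simple[of 0] by (cases "c = 0") auto
    next
      case False
      then have "countable {z \<in> UNIV. F z = 0}"
        using F fsigma.intros[of "\<lambda>_. UNIV"] by (intro holomorphic_countable_zeros) auto
      then show ?thesis by simp
    qed
    then have nz: "AE z in lborel. F z \<noteq> 0"
      using AE_not_in[OF countable_imp_null_set_lborel] by fastforce
    have unique: "f = (\<lambda>_. 0)" if f: "f \<in> fock_space p" and van: "\<And>z. F z = 0 \<Longrightarrow> f z = 0" for f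
    proof -
      have hol: "f holomorphic_on UNIV" using f by (simp add: fock_space_def)
      obtain g where g: "g holomorphic_on UNIV" "\<And>z. f z = g z * F z"
        using holomorphic_quotient_simple_zeros[OF hol F simple van] by blast
      obtain C where C: "\<And>z. norm (f z) \<le> C * exp ((norm z + 3)\<^sup>2 / 2)"
        using fock_space_pointwise_bound[OF f assms(4)] by blast
      have "0 \<le> C * exp ((norm (0::complex) + 3)\<^sup>2 / 2)" using C[of 0] norm_ge_zero by (rule order.trans[rotated])
      then have C0: "0 \<le> C" by (simp add: zero_le_mult_iff)
      have "(\<integral>\<^sup>+z. ennreal (norm (g z)) \<partial>lborel) \<le>
        (\<integral>\<^sup>+z. ennreal C * (ennreal (exp ((norm z + 3)\<^sup>2 / 2)) * ennreal (1 / norm (F z))) \<partial>lborel)"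
      proof (rule nn_integral_mono_AE)
        show "AE z in lborel. ennreal (norm (g z))
            \<le> ennreal C * (ennreal (exp ((norm z + 3)\<^sup>2 / 2)) * ennreal (1 / norm (F z)))"
          using nz
        proof eventually_elim
          case (elim z)
          then have "norm (g z) = norm (f z) * (1 / norm (F z))"
            by (simp add: g(2) norm_mult)
          also have "\<dots> \<le> C * exp ((norm z + 3)\<^sup>2 / 2) * (1 / norm (F z))"
            by (intro mult_right_mono C) simp
          finally show ?case
            using C0 by (simp add: mult.assoc ennreal_leI flip: ennreal_mult)
        qed
      qed
      also have "\<dots> < \<infinity>"
        using elim(3) by (subst nn_integral_cmult) (auto simp: F_def[symmetric] ennreal_mult_less_top)
      finally have "g z = 0" for z by (rule entire_integrable_imp_zero[OF g(1)])
      then show ?thesis by (simp add: g(2) fun_eq_iff)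
    qed
    have zeros: "gef_zeros L (\<lambda>n. \<zeta> n \<omega>) = {z. F z = 0}"
      by (simp add: gef_zeros_def F_def)
    have zero: "(\<lambda>_. 0) \<in> fock_space p"
      by (simp add: fock_space_def fock_norm_powr_def)
    show ?case unfolding zeros
    proof (intro equalityI subsetI)
      fix f assume "f \<in> {f \<in> fock_space p. \<forall>z\<in>{z. F z = 0}. f z = 0}"
      then have "f = (\<lambda>_. 0)" by (intro unique) blast+
      then show "f \<in> {\<lambda>_. 0}" by simp
    qed (use zero in simp)
  qed
qed

end
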